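(* Let $n \ge 1$, let $\mu_3 > \mu_1 > 0$, and let $f = (f_1,\ldots,f_n)^T : \mathbb{R}^n \to \mathbb{R}^n$ be a vector valued function each of whose entries $f_i$ is a polynomial in $n$ variables. Then the Liouville operator $A_f : F^2_{\mu_1}(\mathbb{R}^n) \to F^2_{\mu_3}(\mathbb{R}^n)$ defined by $A_f g = \nabla g \cdot f = \sum_{i=1}^n f_i \frac{\partial g}{\partial x_i}$ is a compact operator.
   Context: For $\mu > 0$, $F^2_\mu(\mathbb{R}^n)$ denotes the native space (reproducing kernel Hilbert space of real-valued functions on $\mathbb{R}^n$) of the exponential dot product kernel $K(x,y) = \exp(\mu x^T y)$. Explicitly, it is the Hilbert space of functions $g(x) = \sum_{\alpha \in \mathbb{N}^n} a_\alpha x^\alpha$ (with $\mathbb{N}$ including $0$, $a_\alpha\in\mathbb{R}$) with $\|g\|_\mu^2 := \sum_{\alpha} |a_\alpha|^2 \frac{\alpha!}{\mu^{|\alpha|}} < \infty$, where for a multi-index $\alpha$, $\alpha! = \alpha_1!\cdots\alpha_n!$ and $|\alpha| = \alpha_1+\cdots+\alpha_n$. *)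

theory Defs
  imports "HOL-Analysis.Analysis"
begin

text \<open>Multi-indices in \<open>\<nat>\<^sup>n\<close> are functions \<open>'n \<Rightarrow> nat\<close> on the finite index type of \<open>real ^ 'n\<close>.\<close>

definition mi_abs :: "('n::finite \<Rightarrow> nat) \<Rightarrow> nat" where
  "mi_abs \<alpha> = (\<Sum>i\<in>UNIV. \<alpha> i)"

definition mi_fact :: "('n::finite \<Rightarrow> nat) \<Rightarrow> real" where
  "mi_fact \<alpha> = (\<Prod>i\<in>UNIV. fact (\<alpha> i))"

definition mi_power :: "real ^ 'n \<Rightarrow> ('n::finite \<Rightarrow> nat) \<Rightarrow> real" where
  "mi_power x \<alpha> = (\<Prod>i\<in>UNIV. (x $ i) ^ \<alpha> i)"

definition has_power_series :: "(real ^ 'n::finite \<Rightarrow> real) \<Rightarrow> (('n \<Rightarrow> nat) \<Rightarrow> real) \<Rightarrow> bool" where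
  "has_power_series g a \<longleftrightarrow> (\<forall>x. ((\<lambda>\<alpha>. a \<alpha> * mi_power x \<alpha>) has_sum g x) UNIV)"

text \<open>The native space of the kernel \<open>exp (\<mu> * (x \<bullet> y))\<close>. The coefficients of a power
  series that converges on all of \<open>real ^ 'n\<close> are uniquely determined by its sum, so on
  \<open>fock_space \<mu>\<close> the definite description in \<open>ps_coeff\<close> is proper.\<close>

definition fock_space :: "real \<Rightarrow> (real ^ 'n::finite \<Rightarrow> real) set" where
  "fock_space \<mu> = {g. \<exists>a. has_power_series g a \<and>
     (\<lambda>\<alpha>. \<bar>a \<alpha>\<bar>\<^sup>2 * (mi_fact \<alpha> / \<mu> ^ mi_abs \<alpha>)) summable_on UNIV}"

definition ps_coeff :: "(real ^ 'n::finite \<Rightarrow> real) \<Rightarrow> ('n \<Rightarrow> nat) \<Rightarrow> real" where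
  "ps_coeff g = (THE a. has_power_series g a)"

definition fock_norm :: "real \<Rightarrow> (real ^ 'n::finite \<Rightarrow> real) \<Rightarrow> real" where
  "fock_norm \<mu> g = sqrt (\<Sum>\<^sub>\<infinity>\<alpha>. \<bar>ps_coeff g \<alpha>\<bar>\<^sup>2 * (mi_fact \<alpha> / \<mu> ^ mi_abs \<alpha>))"

definition partial_deriv :: "'n::finite \<Rightarrow> (real ^ 'n \<Rightarrow> real) \<Rightarrow> real ^ 'n \<Rightarrow> real" where
  "partial_deriv i g x = deriv (\<lambda>t. g (x + t *\<^sub>R axis i 1)) 0"

definition liouville :: "(real ^ 'n::finite \<Rightarrow> real ^ 'n) \<Rightarrow> (real ^ 'n \<Rightarrow> real) \<Rightarrow> real ^ 'n \<Rightarrow> real" where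
  "liouville f g x = (\<Sum>i\<in>UNIV. f x $ i * partial_deriv i g x)"

text \<open>Compactness of an operator between normed spaces of real functions, each given by its
  carrier and its norm (the norm depends on a real parameter, so it cannot be attached to
  the type): a linear map of \<open>V\<close> into \<open>W\<close> sending bounded sets to relatively compact sets.\<close>

definition norm_dist :: "(('a \<Rightarrow> real) \<Rightarrow> real) \<Rightarrow> ('a \<Rightarrow> real) \<Rightarrow> ('a \<Rightarrow> real) \<Rightarrow> real" where
  "norm_dist N g h = N (\<lambda>x. g x - h x)"

definition norm_topology :: "('a \<Rightarrow> real) set \<Rightarrow> (('a \<Rightarrow> real) \<Rightarrow> real) \<Rightarrow> ('a \<Rightarrow> real) topology" where
  "norm_topology V N = Metric_space.mtopology V (norm_dist N)"

definition linear_between ::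
  "('a \<Rightarrow> real) set \<Rightarrow> ('b \<Rightarrow> real) set \<Rightarrow> (('a \<Rightarrow> real) \<Rightarrow> 'b \<Rightarrow> real) \<Rightarrow> bool" where
  "linear_between V W T \<longleftrightarrow>
     (\<forall>g\<in>V. T g \<in> W) \<and>
     (\<forall>g\<in>V. \<forall>h\<in>V. T (\<lambda>x. g x + h x) = (\<lambda>y. T g y + T h y)) \<and>
     (\<forall>c. \<forall>g\<in>V. T (\<lambda>x. c * g x) = (\<lambda>y. c * T g y))"

definition compact_operator ::
  "('a \<Rightarrow> real) set \<Rightarrow> (('a \<Rightarrow> real) \<Rightarrow> real) \<Rightarrow> ('b \<Rightarrow> real) set \<Rightarrow> (('b \<Rightarrow> real) \<Rightarrow> real) \<Rightarrow>
   (('a \<Rightarrow> real) \<Rightarrow> 'b \<Rightarrow> real) \<Rightarrow> bool" where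
  "compact_operator V N W M T \<longleftrightarrow>
     linear_between V W T \<and>
     (\<forall>B\<subseteq>V. (\<exists>c. \<forall>g\<in>B. N g \<le> c) \<longrightarrow>
        compactin (norm_topology W M) (norm_topology W M closure_of (T ` B)))"

end

theory Submission
  imports Defs "HOL-Complex_Analysis.Great_Picard"
begin

text \<open>On coefficients, multiplication by a coordinate and a partial derivative are shifts that cost
  at most a factor polynomial in the degree, while enlarging the parameter from \<open>\<mu>\<close> to \<open>\<nu>\<close>
  multiplies the weight of degree \<open>k\<close> by \<open>(\<mu> / \<nu>) ^ k\<close>. Hence both are bounded for every
  \<open>\<mu> < \<nu>\<close>, and so are, by splitting the parameter gap, multiplication by a polynomial and the
  Liouville operator. For \<open>\<mu>\<^sub>1 < \<mu>\<^sub>2 < \<mu>\<^sub>3\<close> the operator therefore maps bounded sets into balls for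
  \<open>\<mu>\<^sub>2\<close>, and these balls are compact for \<open>\<mu>\<^sub>3\<close>: a diagonal subsequence converges coefficientwise,
  and the geometric gain in the weights makes the tails uniformly small.\<close>

section \<open>Multi-indices\<close>

text \<open>As \<open>\<beta> i = 0\<close>, the factor \<open>mi_power x \<beta>\<close> does not
  depend on \<open>x $ i\<close>. Taking \<open>s = 0\<close> splits a monomial by its exponent in
  direction \<open>i\<close>; a general \<open>s\<close> follows it along that axis.\<close>

lemma mi_power_upd:
  fixes x :: "real ^ 'n::finite"
  assumes "\<beta> i = 0"
  shows "mi_power (x + s *\<^sub>R axis i 1) (\<beta>(i := k)) = (x $ i + s) ^ k * mi_power x \<beta>"
proof -
  have "mi_power (x + s *\<^sub>R axis i 1) (\<beta>(i := k))
      = (x $ i + s) ^ k * (\<Prod>j\<in>UNIV - {i}. x $ j ^ \<beta> j)"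
    unfolding mi_power_def
    by (subst prod.remove[of _ i]) (auto simp: axis_def intro!: prod.cong)
  also have "(\<Prod>j\<in>UNIV - {i}. x $ j ^ \<beta> j) = mi_power x \<beta>"
    unfolding mi_power_def using assms by (subst (2) prod.remove[of _ i]) auto
  finally show ?thesis .
qed

lemma mi_power_Suc:
  fixes x :: "real ^ 'n::finite"
  shows "mi_power x (\<alpha>(i := Suc (\<alpha> i))) = x $ i * mi_power x \<alpha>"
  using mi_power_upd[of "\<alpha>(i := 0)" i x 0 "Suc (\<alpha> i)"] mi_power_upd[of "\<alpha>(i := 0)" i x 0 "\<alpha> i"]
  by simp

lemma mi_fact_Suc: "mi_fact (\<alpha>(i := Suc (\<alpha> i))) = (real (\<alpha> i) + 1) * mi_fact \<alpha>"
proof -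
  have "mi_fact (\<alpha>(i := Suc (\<alpha> i))) = fact (Suc (\<alpha> i)) * (\<Prod>j\<in>UNIV - {i}. fact (\<alpha> j))"
    unfolding mi_fact_def by (subst prod.remove[of _ i]) (auto intro!: prod.cong)
  moreover have "mi_fact \<alpha> = fact (\<alpha> i) * (\<Prod>j\<in>UNIV - {i}. fact (\<alpha> j))"
    unfolding mi_fact_def by (subst prod.remove[of _ i]) auto
  ultimately show ?thesis by (simp add: algebra_simps)
qed

lemma mi_abs_Suc: "mi_abs (\<alpha>(i := Suc (\<alpha> i))) = Suc (mi_abs \<alpha>)"
proof -
  have "mi_abs (\<alpha>(i := Suc (\<alpha> i))) = Suc (\<alpha> i) + (\<Sum>j\<in>UNIV - {i}. \<alpha> j)"
    unfolding mi_abs_def by (subst sum.remove[of _ i]) (auto intro!: sum.cong)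
  moreover have "mi_abs \<alpha> = \<alpha> i + (\<Sum>j\<in>UNIV - {i}. \<alpha> j)"
    unfolding mi_abs_def by (subst sum.remove[of _ i]) auto
  ultimately show ?thesis by simp
qed

lemma le_mi_abs: "\<alpha> i \<le> mi_abs \<alpha>"
  unfolding mi_abs_def by (rule member_le_sum) auto

lemma mi_fact_pos: "0 < mi_fact \<alpha>"
  unfolding mi_fact_def by (rule prod_pos) auto

lemma finite_mi_abs_le: "finite {\<alpha> :: 'n::finite \<Rightarrow> nat. mi_abs \<alpha> \<le> N}"
proof (rule finite_subset)
  show "{\<alpha>. mi_abs \<alpha> \<le> N} \<subseteq> PiE UNIV (\<lambda>_. {..N})"
    using le_mi_abs order_trans by fastforce
qed (auto intro: finite_PiE)

lemma countable_multi_indices: "countable (UNIV :: ('n::finite \<Rightarrow> nat) set)"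
  using countable_PiE[of "UNIV :: 'n set" "\<lambda>_. UNIV :: nat set"] by (simp add: PiE_UNIV_domain)

lemma inj_Suc_upd: "inj (\<lambda>\<alpha> :: 'n \<Rightarrow> nat. \<alpha>(i := Suc (\<alpha> i)))"
proof (rule injI)
  fix \<alpha> \<beta> :: "'n \<Rightarrow> nat"
  assume *: "\<alpha>(i := Suc (\<alpha> i)) = \<beta>(i := Suc (\<beta> i))"
  show "\<alpha> = \<beta>"
  proof
    show "\<alpha> j = \<beta> j" for j using fun_cong[OF *, of j] by (cases "j = i") auto
  qed
qed

section \<open>Entire power series in several variables\<close>

lemma has_power_series_add:
  "has_power_series g a \<Longrightarrow> has_power_series h b \<Longrightarrow>
    has_power_series (\<lambda>x. g x + h x) (\<lambda>\<alpha>. a \<alpha> + b \<alpha>)"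
  unfolding has_power_series_def by (auto simp: distrib_right intro!: has_sum_add)

lemma has_power_series_cmult:
  "has_power_series g a \<Longrightarrow> has_power_series (\<lambda>x. c * g x) (\<lambda>\<alpha>. c * a \<alpha>)"
  unfolding has_power_series_def by (auto simp: mult.assoc intro!: has_sum_cmult_right)

lemma has_power_series_diff:
  "has_power_series g a \<Longrightarrow> has_power_series h b \<Longrightarrow>
    has_power_series (\<lambda>x. g x - h x) (\<lambda>\<alpha>. a \<alpha> - b \<alpha>)"
  using has_power_series_add[OF _ has_power_series_cmult[of h b "-1"]] by simp

lemma has_power_series_unique_fun:
  "has_power_series g a \<Longrightarrow> has_power_series h a \<Longrightarrow> g = h"
  unfolding has_power_series_def by (blast intro: has_sum_unique)

lemma has_power_series_coord:
  fixes g :: "real ^ 'n::finite \<Rightarrow> real"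
  assumes "has_power_series g a"
  shows "has_power_series (\<lambda>x. x $ i * g x)
           (\<lambda>\<alpha>. if \<alpha> i = 0 then 0 else a (\<alpha>(i := \<alpha> i - 1)))"
  unfolding has_power_series_def
proof
  fix x :: "real ^ 'n"
  let ?b = "\<lambda>\<alpha>. if \<alpha> i = 0 then 0 else a (\<alpha>(i := \<alpha> i - 1))"
  have "((\<lambda>\<alpha>. x $ i * (a \<alpha> * mi_power x \<alpha>)) has_sum (x $ i * g x)) UNIV"
    using assms by (auto simp: has_power_series_def intro!: has_sum_cmult_right)
  \<comment> \<open>Raising the exponent at \<open>i\<close> is a bijection from all multi-indices
    onto those with \<open>\<alpha> i \<noteq> 0\<close>; the remaining ones, where natural
    subtraction would truncate, carry the coefficient 0.\<close>
  also have "?this \<longleftrightarrow> ((\<lambda>\<alpha>. ?b \<alpha> * mi_power x \<alpha>) has_sum (x $ i * g x)) {\<alpha>. \<alpha> i \<noteq> 0}"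
    by (rule has_sum_reindex_bij_witness
          [where j = "\<lambda>\<alpha>. \<alpha>(i := Suc (\<alpha> i))" and i = "\<lambda>\<alpha>. \<alpha>(i := \<alpha> i - 1)"])
       (auto simp: mi_power_Suc)
  also have "\<dots> \<longleftrightarrow> ((\<lambda>\<alpha>. ?b \<alpha> * mi_power x \<alpha>) has_sum (x $ i * g x)) UNIV"
    by (rule has_sum_cong_neutral) auto
  finally show "((\<lambda>\<alpha>. ?b \<alpha> * mi_power x \<alpha>) has_sum (x $ i * g x)) UNIV" .
qed

text \<open>The left side is one term of the binomial expansion of the right side. It bounds the
  terms of a differentiated series at \<open>u\<close> by those of the original series at
  \<open>u + 1\<close>.\<close>

lemma Suc_mult_power_le:
  fixes u :: real
  assumes "0 \<le> u"
  shows "real (Suc k) * u ^ k \<le> (u + 1) ^ Suc k"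
proof (induction k)
  case (Suc k)
  have "real (Suc (Suc k)) * u ^ Suc k = u * (real (Suc k) * u ^ k) + u ^ Suc k"
    by (simp add: algebra_simps)
  also have "\<dots> \<le> u * (u + 1) ^ Suc k + (u + 1) ^ Suc k"
    using Suc assms by (intro add_mono mult_left_mono power_mono) auto
  also have "\<dots> = (u + 1) ^ Suc (Suc k)" by (simp add: algebra_simps)
  finally show ?case .
qed (use assms in simp)

text \<open>Grouping the monomials by the exponent of \<open>x $ i\<close> turns the series into a power series in
  one variable, to which the library theorem on termwise differentiation applies.\<close>

lemma has_power_series_partial_deriv:
  fixes g :: "real ^ 'n::finite \<Rightarrow> real"
  assumes "has_power_series g a"
  shows "has_power_series (partial_deriv i g)
           (\<lambda>\<alpha>. (real (\<alpha> i) + 1) * a (\<alpha>(i := Suc (\<alpha> i))))"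
  unfolding has_power_series_def
proof
  fix x :: "real ^ 'n"
  define B where "B = {\<beta> :: 'n \<Rightarrow> nat. \<beta> i = 0}"
  define A where "A k \<beta> = a (\<beta>(i := k)) * mi_power x \<beta>" for k \<beta>
  define b where "b k = infsum (A k) B" for k
  \<comment> \<open>Each multi-index is \<open>\<beta>(i := k)\<close> for exactly one pair with
    \<open>\<beta> i = 0\<close>.\<close>
  have reindex: "((\<lambda>(k, \<beta>). F (\<beta>(i := k))) has_sum S) (UNIV \<times> B) \<longleftrightarrow> (F has_sum S) UNIV"
    for F :: "('n \<Rightarrow> nat) \<Rightarrow> real" and S
    by (rule has_sum_reindex_bij_witness
          [where j = "\<lambda>(k, \<beta>). \<beta>(i := k)" and i = "\<lambda>\<alpha>. (\<alpha> i, \<alpha>(i := 0))"])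
       (auto simp: B_def)
  \<comment> \<open>The line through \<open>x\<close> in direction \<open>i\<close> is parametrised
    so that its \<open>i\<close>-th coordinate is \<open>t\<close> itself.\<close>
  have sum2: "((\<lambda>(k, \<beta>). A k \<beta> * t ^ k) has_sum g (x + (t - x $ i) *\<^sub>R axis i 1)) (UNIV \<times> B)" for t
  proof -
    let ?y = "x + (t - x $ i) *\<^sub>R axis i 1"
    have "((\<lambda>\<alpha>. a \<alpha> * mi_power ?y \<alpha>) has_sum g ?y) UNIV"
      using assms by (simp add: has_power_series_def)
    then have "((\<lambda>(k, \<beta>). a (\<beta>(i := k)) * mi_power ?y (\<beta>(i := k))) has_sum g ?y) (UNIV \<times> B)"
      by (subst reindex)
    then show ?thesis
      by (rule iffD1[OF has_sum_cong, rotated]) (auto simp: B_def A_def mi_power_upd)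
  qed
  have A_summable: "A k summable_on B" for k
  proof -
    have "(\<lambda>(k, \<beta>). A k \<beta> * 1 ^ k) summable_on (UNIV \<times> B)"
      using sum2[of 1] by (rule has_sum_imp_summable)
    from summable_on_SigmaD1[OF this, of k] show ?thesis by simp
  qed
  have bk: "(A k has_sum b k) B" for k
    unfolding b_def using A_summable by (rule has_sum_infsum)
  have b_sums: "(\<lambda>k. b k * t ^ k) sums g (x + (t - x $ i) *\<^sub>R axis i 1)" for t
    by (rule has_sum_imp_sums, rule has_sum_SigmaD[OF sum2])
       (auto intro!: has_sum_cmult_left bk)
  have "((\<lambda>t. \<Sum>k. b k * t ^ k) has_field_derivative (\<Sum>k. diffs b k * (x $ i) ^ k)) (at (x $ i))"
    by (rule termdiffs_strong_converges_everywhere) (use b_sums sums_summable in blast)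
  then have "((\<lambda>t. g (x + (t - x $ i) *\<^sub>R axis i 1)) has_field_derivative
      (\<Sum>k. diffs b k * (x $ i) ^ k)) (at (x $ i))"
    using sums_unique[OF b_sums] by simp
  then have "((\<lambda>t. g (x + t *\<^sub>R axis i 1)) has_field_derivative
      (\<Sum>k. diffs b k * (x $ i) ^ k)) (at 0)"
    using DERIV_shift[of "\<lambda>t. g (x + (t - x $ i) *\<^sub>R axis i 1)" _ 0 "x $ i"] by simp
  then have deriv: "partial_deriv i g x = (\<Sum>k. diffs b k * (x $ i) ^ k)"
    unfolding partial_deriv_def by (rule DERIV_imp_deriv)
  let ?D = "\<lambda>k \<beta>. real (Suc k) * A (Suc k) \<beta> * (x $ i) ^ k"
  have "(\<lambda>(k, \<beta>). ?D k \<beta>) summable_on (UNIV \<times> B)"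
  proof -
    \<comment> \<open>The original series converges absolutely at every \<open>t\<close>; one unit
      beyond \<open>\<bar>x $ i\<bar>\<close> suffices to dominate the differentiated terms.\<close>
    define t where "t = \<bar>x $ i\<bar> + 1"
    have "(\<lambda>p. norm ((\<lambda>(k, \<beta>). A k \<beta> * t ^ k) p)) summable_on (UNIV \<times> B)"
      by (rule iffD1[OF summable_on_iff_abs_summable_on_real has_sum_imp_summable[OF sum2]])
    then have "(\<lambda>(k, \<beta>). \<bar>A k \<beta> * t ^ k\<bar>) summable_on ((\<lambda>(k, \<beta>). (Suc k, \<beta>)) ` (UNIV \<times> B))"
      by (rule summable_on_subset[OF iffD1[OF summable_on_cong], rotated]) (auto split: prod.splits)
    then have "(\<lambda>(k, \<beta>). \<bar>A (Suc k) \<beta> * t ^ Suc k\<bar>) summable_on (UNIV \<times> B)"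
      by (subst (asm) summable_on_reindex) (auto simp: inj_on_def o_def case_prod_unfold)
    then have "(\<lambda>p. norm ((\<lambda>(k, \<beta>). ?D k \<beta>) p)) summable_on (UNIV \<times> B)"
    proof (rule summable_on_comparison_test, goal_cases)
      case (1 p)
      obtain k \<beta> where p: "p = (k, \<beta>)" by fastforce
      have "real (Suc k) * \<bar>x $ i\<bar> ^ k \<le> t ^ Suc k"
        unfolding t_def by (rule Suc_mult_power_le) simp
      then have "\<bar>A (Suc k) \<beta>\<bar> * (real (Suc k) * \<bar>x $ i\<bar> ^ k) \<le> \<bar>A (Suc k) \<beta>\<bar> * t ^ Suc k"
        by (rule mult_left_mono) simp
      then show ?case
        by (simp add: p abs_mult power_abs t_def mult_ac del: power_Suc of_nat_Suc)
    qed auto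
    then show ?thesis by (rule abs_summable_summable)
  qed
  then obtain S where S: "((\<lambda>(k, \<beta>). ?D k \<beta>) has_sum S) (UNIV \<times> B)"
    by (auto simp: summable_on_def)
  \<comment> \<open>The differentiated double series is evaluated twice: by rows it gives the
    derivative, and through \<open>reindex\<close> the series over multi-indices.\<close>
  have "((\<lambda>k. real (Suc k) * b (Suc k) * (x $ i) ^ k) has_sum S) UNIV"
    by (rule has_sum_SigmaD[OF S]) (auto intro!: has_sum_cmult_left has_sum_cmult_right bk simp del: of_nat_Suc)
  from has_sum_imp_sums[OF this] have "S = partial_deriv i g x"
    unfolding deriv diffs_def by (rule sums_unique)
  moreover have "((\<lambda>(k, \<beta>). (\<lambda>\<alpha>. (real (\<alpha> i) + 1) * a (\<alpha>(i := Suc (\<alpha> i))) * mi_power x \<alpha>) (\<beta>(i := k)))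
      has_sum S) (UNIV \<times> B)"
    by (rule iffD1[OF has_sum_cong S])
       (use mi_power_upd[of _ i x 0] in \<open>auto simp: B_def A_def algebra_simps\<close>)
  ultimately show "((\<lambda>\<alpha>. (real (\<alpha> i) + 1) * a (\<alpha>(i := Suc (\<alpha> i))) * mi_power x \<alpha>) has_sum
      partial_deriv i g x) UNIV"
    by (subst (asm) reindex) simp
qed

text \<open>Up to a positive factor, the coefficient at \<open>\<alpha>\<close> is the derivative of order \<open>\<alpha>\<close> at the
  origin.\<close>

lemma has_power_series_0_imp:
  fixes g :: "real ^ 'n::finite \<Rightarrow> real"
  assumes "has_power_series g a" and "\<And>x. g x = 0"
  shows "a \<alpha> = 0"
  using assms
\<comment> \<open>\<open>g\<close> and \<open>a\<close> vary because the induction hypothesis is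
  applied to \<open>partial_deriv i g\<close>, which vanishes too.\<close>
proof (induction "mi_abs \<alpha>" arbitrary: \<alpha> g a)
  case 0
  then have \<alpha>: "\<alpha> = (\<lambda>_. 0)" by (auto simp: mi_abs_def)
  \<comment> \<open>At the origin only the constant monomial survives, with value 1 because
    \<open>0 ^ 0 = 1\<close>.\<close>
  have "((\<lambda>\<beta>. a \<beta> * mi_power (0 :: real ^ 'n) \<beta>) has_sum 0) UNIV"
    using 0(2,3) unfolding has_power_series_def by metis
  also have "?this \<longleftrightarrow> ((\<lambda>\<beta>. a \<beta>) has_sum 0) {\<alpha>}"
    by (rule has_sum_cong_neutral) (auto simp: mi_power_def \<alpha>)
  finally show ?case by (auto simp: has_sum_finite_iff)
next
  case (Suc m)
  have "\<exists>i. \<alpha> i \<noteq> 0"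
  proof (rule ccontr)
    assume "\<nexists>i. \<alpha> i \<noteq> 0"
    then have "mi_abs \<alpha> = 0" by (simp add: mi_abs_def)
    then show False using Suc(2) by simp
  qed
  then obtain i where i: "\<alpha> i \<noteq> 0" by blast
  define \<beta> where "\<beta> = \<alpha>(i := \<alpha> i - 1)"
  have \<alpha>: "\<alpha> = \<beta>(i := Suc (\<beta> i))" using i by (auto simp: \<beta>_def)
  have "m = mi_abs \<beta>" using Suc(2) \<alpha> mi_abs_Suc[of \<beta> i] by simp
  moreover have "partial_deriv i g x = 0" for x
    using Suc.prems(2) by (simp add: partial_deriv_def)
  ultimately have "(real (\<beta> i) + 1) * a (\<beta>(i := Suc (\<beta> i))) = 0"
    using Suc.hyps(1) has_power_series_partial_deriv[OF Suc.prems(1)] by blast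
  moreover have "real (\<beta> i) + 1 \<noteq> 0" by linarith
  ultimately show ?case using \<alpha> by simp
qed

lemma has_power_series_unique:
  assumes "has_power_series g a" and "has_power_series g b"
  shows "a = b"
proof
  fix \<alpha>
  show "a \<alpha> = b \<alpha>"
    using has_power_series_0_imp[OF has_power_series_diff[OF assms], of \<alpha>] by simp
qed

lemma ps_coeff_eq: "has_power_series g a \<Longrightarrow> ps_coeff g = a"
  unfolding ps_coeff_def using has_power_series_unique by blast

section \<open>The norm of the native space\<close>

text \<open>For \<open>\<mu> > 0\<close> this is the squared norm of the monomial with exponent
  \<open>\<alpha>\<close>.\<close>

definition mi_weight :: "real \<Rightarrow> ('n::finite \<Rightarrow> nat) \<Rightarrow> real" where
  "mi_weight \<mu> \<alpha> = mi_fact \<alpha> / \<mu> ^ mi_abs \<alpha>"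

lemma mi_weight_pos: "0 < \<mu> \<Longrightarrow> 0 < mi_weight \<mu> \<alpha>"
  by (simp add: mi_weight_def mi_fact_pos)

lemma mi_weight_nonneg [simp]: "0 < \<mu> \<Longrightarrow> 0 \<le> mi_weight \<mu> \<alpha>"
  using mi_weight_pos less_imp_le by blast

lemma mi_weight_Suc:
  "0 < \<mu> \<Longrightarrow> mi_weight \<mu> (\<alpha>(i := Suc (\<alpha> i))) = (real (\<alpha> i) + 1) / \<mu> * mi_weight \<mu> \<alpha>"
  by (simp add: mi_weight_def mi_fact_Suc mi_abs_Suc)

lemma mi_weight_change:
  "0 < \<mu> \<Longrightarrow> 0 < \<nu> \<Longrightarrow> mi_weight \<nu> \<alpha> = (\<mu> / \<nu>) ^ mi_abs \<alpha> * mi_weight \<mu> \<alpha>"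
  by (simp add: mi_weight_def power_divide)

text \<open>With \<open>r = \<mu> / \<nu> < 1\<close> the sequence \<open>(k + 1) * r ^ k\<close> is
  bounded, so a strict gap between the parameters pays for a factor linear in the degree.\<close>

lemma mi_weight_absorb:
  assumes "0 < \<mu>" and "\<mu> < \<nu>"
  obtains C where "0 \<le> C"
    and "\<And>\<alpha> :: 'n::finite \<Rightarrow> nat. (real (mi_abs \<alpha>) + 1) * mi_weight \<nu> \<alpha> \<le> C * mi_weight \<mu> \<alpha>"
proof -
  define r where "r = \<mu> / \<nu>"
  have r: "0 < r" "r < 1" using assms by (auto simp: r_def)
  have "(\<lambda>k. of_nat k * r ^ k + r ^ k) \<longlonglongrightarrow> 0 + 0"
    using r by (intro tendsto_add powser_times_n_limit_0 LIMSEQ_realpow_zero) auto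
  then have "Bseq (\<lambda>k. of_nat k * r ^ k + r ^ k)"
    by (rule convergent_imp_Bseq[OF convergentI])
  then obtain C where C: "0 < C" "\<And>k. norm (of_nat k * r ^ k + r ^ k) \<le> C"
    by (auto simp: Bseq_def)
  have "(real (mi_abs \<alpha>) + 1) * mi_weight \<nu> \<alpha> \<le> C * mi_weight \<mu> \<alpha>" for \<alpha> :: "'n \<Rightarrow> nat"
  proof -
    have "(real (mi_abs \<alpha>) + 1) * r ^ mi_abs \<alpha> \<le> C"
      using C(2)[of "mi_abs \<alpha>"] by (simp add: algebra_simps)
    from mult_right_mono[OF this mi_weight_nonneg[OF assms(1)]]
    show ?thesis using assms mi_weight_change[of \<mu> \<nu> \<alpha>] by (simp add: r_def mult_ac)
  qed
  then show thesis using C(1) that by (meson less_imp_le)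
qed

lemma fock_space_iff:
  "g \<in> fock_space \<mu> \<longleftrightarrow>
    has_power_series g (ps_coeff g) \<and> (\<lambda>\<alpha>. (ps_coeff g \<alpha>)\<^sup>2 * mi_weight \<mu> \<alpha>) summable_on UNIV"
  unfolding fock_space_def mi_weight_def using ps_coeff_eq by auto

lemma fock_norm_nonneg: "0 < \<mu> \<Longrightarrow> 0 \<le> fock_norm \<mu> g"
  unfolding fock_norm_def mi_weight_def[symmetric]
  by (intro real_sqrt_ge_zero infsum_nonneg) simp

lemma fock_norm_sq:
  assumes "0 < \<mu>"
  shows "(fock_norm \<mu> g)\<^sup>2 = (\<Sum>\<^sub>\<infinity>\<alpha>. (ps_coeff g \<alpha>)\<^sup>2 * mi_weight \<mu> \<alpha>)"
proof -
  have "0 \<le> (\<Sum>\<^sub>\<infinity>\<alpha>. (ps_coeff g \<alpha>)\<^sup>2 * mi_weight \<mu> \<alpha>)"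
    using assms by (intro infsum_nonneg) simp
  then show ?thesis by (simp add: fock_norm_def mi_weight_def[symmetric])
qed

lemma finite_sum_le_fock_norm:
  assumes "0 < \<mu>" "g \<in> fock_space \<mu>" "finite F"
  shows "(\<Sum>\<alpha>\<in>F. (ps_coeff g \<alpha>)\<^sup>2 * mi_weight \<mu> \<alpha>) \<le> (fock_norm \<mu> g)\<^sup>2"
  unfolding fock_norm_sq[OF assms(1)]
  by (rule finite_sum_le_infsum)
     (use assms in \<open>auto simp: fock_space_iff\<close>)

text \<open>All terms are nonnegative, so a bound on the finite partial sums gives both summability
  and the norm estimate. Later estimates thereby reduce to finite sums.\<close>

lemma fock_spaceI:
  assumes "0 < \<mu>" "has_power_series g a" "0 \<le> C"
    and "\<And>F. finite F \<Longrightarrow> (\<Sum>\<alpha>\<in>F. (a \<alpha>)\<^sup>2 * mi_weight \<mu> \<alpha>) \<le> C\<^sup>2"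
  shows "g \<in> fock_space \<mu>" and "fock_norm \<mu> g \<le> C"
proof -
  note a = ps_coeff_eq[OF assms(2)]
  have s: "(\<lambda>\<alpha>. (a \<alpha>)\<^sup>2 * mi_weight \<mu> \<alpha>) summable_on UNIV"
    by (rule nonneg_bounded_partial_sums_imp_summable_on[where C = "C\<^sup>2"])
       (use assms in \<open>auto intro!: eventually_finite_subsets_at_top_weakI\<close>)
  then show "g \<in> fock_space \<mu>" using assms(2) a by (simp add: fock_space_iff)
  have "(fock_norm \<mu> g)\<^sup>2 \<le> C\<^sup>2"
    unfolding fock_norm_sq[OF assms(1)] a using s assms(4) by (intro infsum_le_finite_sums) auto
  then show "fock_norm \<mu> g \<le> C" using assms(3) by (rule power2_le_imp_le)
qed

text \<open>This is Minkowski's inequality on finite index sets, applied to the coefficients scaled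
  by the square roots of the weights.\<close>

lemma fock_space_add:
  fixes g h :: "real ^ 'n::finite \<Rightarrow> real"
  assumes "0 < \<mu>" "g \<in> fock_space \<mu>" "h \<in> fock_space \<mu>"
  shows "(\<lambda>x. g x + h x) \<in> fock_space \<mu>"
    and "fock_norm \<mu> (\<lambda>x. g x + h x) \<le> fock_norm \<mu> g + fock_norm \<mu> h"
proof -
  let ?a = "ps_coeff g" and ?b = "ps_coeff h" and ?C = "fock_norm \<mu> g + fock_norm \<mu> h"
  have ps: "has_power_series (\<lambda>x. g x + h x) (\<lambda>\<alpha>. ?a \<alpha> + ?b \<alpha>)"
    using assms by (simp add: fock_space_iff has_power_series_add)
  have C: "0 \<le> ?C" using assms(1) by (simp add: fock_norm_nonneg)
  have L2: "L2_set (\<lambda>\<alpha>. ps_coeff k \<alpha> * sqrt (mi_weight \<mu> \<alpha>)) F \<le> fock_norm \<mu> k"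
    if "k \<in> fock_space \<mu>" "finite F" for k :: "real ^ 'n \<Rightarrow> real" and F
    using finite_sum_le_fock_norm[OF assms(1) that] assms(1) fock_norm_nonneg[OF assms(1), of k]
    by (simp add: L2_set_def power_mult_distrib real_le_lsqrt)
  have "(\<Sum>\<alpha>\<in>F. (?a \<alpha> + ?b \<alpha>)\<^sup>2 * mi_weight \<mu> \<alpha>) \<le> ?C\<^sup>2" if "finite F" for F
  proof -
    have "L2_set (\<lambda>\<alpha>. ?a \<alpha> * sqrt (mi_weight \<mu> \<alpha>) + ?b \<alpha> * sqrt (mi_weight \<mu> \<alpha>)) F \<le> ?C"
      by (rule order_trans[OF L2_set_triangle_ineq add_mono[OF L2[OF assms(2) that] L2[OF assms(3) that]]])
    then have "(L2_set (\<lambda>\<alpha>. (?a \<alpha> + ?b \<alpha>) * sqrt (mi_weight \<mu> \<alpha>)) F)\<^sup>2 \<le> ?C\<^sup>2"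
      by (intro power_mono) (auto simp: distrib_right)
    then show ?thesis
      using assms(1)
      by (simp add: L2_set_def power_mult_distrib sum_nonneg)
  qed
  from fock_spaceI[OF assms(1) ps C this]
  show "(\<lambda>x. g x + h x) \<in> fock_space \<mu>" and "fock_norm \<mu> (\<lambda>x. g x + h x) \<le> ?C" by auto
qed

text \<open>Common source of the estimates for scalar multiples, coordinate multiplication, partial
  derivatives and inclusions: each term for \<open>h\<close> is dominated by a term for
  \<open>g\<close> at the index \<open>\<sigma> \<alpha>\<close>, and injectivity keeps any term of
  \<open>g\<close> from being counted twice.\<close>

lemma fock_space_weighted_shift:
  assumes "0 < \<mu>" "0 < \<nu>" "g \<in> fock_space \<mu>" "has_power_series h b" "0 \<le> D"
    and "inj_on \<sigma> S"
    and "\<And>\<alpha>. \<alpha> \<notin> S \<Longrightarrow> b \<alpha> = 0"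
    and "\<And>\<alpha>. \<alpha> \<in> S \<Longrightarrow>
      (b \<alpha>)\<^sup>2 * mi_weight \<nu> \<alpha> \<le> D\<^sup>2 * ((ps_coeff g (\<sigma> \<alpha>))\<^sup>2 * mi_weight \<mu> (\<sigma> \<alpha>))"
  shows "h \<in> fock_space \<nu>" and "fock_norm \<nu> h \<le> D * fock_norm \<mu> g"
proof -
  have C: "0 \<le> D * fock_norm \<mu> g" using assms(1,5) by (simp add: fock_norm_nonneg)
  have "(\<Sum>\<alpha>\<in>F. (b \<alpha>)\<^sup>2 * mi_weight \<nu> \<alpha>) \<le> (D * fock_norm \<mu> g)\<^sup>2" if "finite F" for F
  proof -
    have "(\<Sum>\<alpha>\<in>F. (b \<alpha>)\<^sup>2 * mi_weight \<nu> \<alpha>) = (\<Sum>\<alpha>\<in>F \<inter> S. (b \<alpha>)\<^sup>2 * mi_weight \<nu> \<alpha>)"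
      using that assms(7) by (intro sum.mono_neutral_right) auto
    also have "\<dots> \<le> (\<Sum>\<alpha>\<in>F \<inter> S. D\<^sup>2 * ((ps_coeff g (\<sigma> \<alpha>))\<^sup>2 * mi_weight \<mu> (\<sigma> \<alpha>)))"
      using assms(8) by (intro sum_mono) auto
    also have "\<dots> = D\<^sup>2 * (\<Sum>\<alpha>\<in>\<sigma> ` (F \<inter> S). (ps_coeff g \<alpha>)\<^sup>2 * mi_weight \<mu> \<alpha>)"
      using inj_on_subset[OF assms(6), of "F \<inter> S"] by (simp add: sum.reindex sum_distrib_left)
    also have "\<dots> \<le> D\<^sup>2 * (fock_norm \<mu> g)\<^sup>2"
      using finite_sum_le_fock_norm[OF assms(1,3)] that by (intro mult_left_mono) auto
    finally show ?thesis by (simp add: power_mult_distrib)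
  qed
  from fock_spaceI[OF assms(2,4) C this]
  show "h \<in> fock_space \<nu>" and "fock_norm \<nu> h \<le> D * fock_norm \<mu> g" by auto
qed

lemma fock_space_cmult:
  assumes "0 < \<mu>" "g \<in> fock_space \<mu>"
  shows "(\<lambda>x. c * g x) \<in> fock_space \<mu>" and "fock_norm \<mu> (\<lambda>x. c * g x) \<le> \<bar>c\<bar> * fock_norm \<mu> g"
proof -
  have "has_power_series (\<lambda>x. c * g x) (\<lambda>\<alpha>. c * ps_coeff g \<alpha>)"
    using assms by (simp add: fock_space_iff has_power_series_cmult)
  note * = fock_space_weighted_shift[OF assms(1) assms(1) assms(2) this, of "\<bar>c\<bar>" "\<lambda>\<alpha>. \<alpha>" UNIV]
  show "(\<lambda>x. c * g x) \<in> fock_space \<mu>" and "fock_norm \<mu> (\<lambda>x. c * g x) \<le> \<bar>c\<bar> * fock_norm \<mu> g"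
    by (rule *; simp add: power_mult_distrib)+
qed

lemma fock_space_diff:
  assumes "0 < \<mu>" "g \<in> fock_space \<mu>" "h \<in> fock_space \<mu>"
  shows "(\<lambda>x. g x - h x) \<in> fock_space \<mu>"
    and "fock_norm \<mu> (\<lambda>x. g x - h x) \<le> fock_norm \<mu> g + fock_norm \<mu> h"
  using fock_space_add[OF assms(1,2) fock_space_cmult(1)[OF assms(1,3), of "-1"]]
    fock_space_cmult(2)[OF assms(1,3), of "-1"] by auto

lemma ps_coeff_diff:
  "g \<in> fock_space \<mu> \<Longrightarrow> h \<in> fock_space \<mu> \<Longrightarrow>
    ps_coeff (\<lambda>x. g x - h x) = (\<lambda>\<alpha>. ps_coeff g \<alpha> - ps_coeff h \<alpha>)"
  by (simp add: fock_space_iff has_power_series_diff ps_coeff_eq)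

text \<open>Stated for arbitrary \<open>g\<close> because \<open>Metric_space\<close> demands a
  symmetric distance outside the carrier as well.\<close>

lemma ps_coeff_uminus: "\<bar>ps_coeff (\<lambda>x. - g x) \<alpha>\<bar> = \<bar>ps_coeff g \<alpha>\<bar>"
proof (cases "\<exists>a. has_power_series g a")
  case True
  then obtain a where a: "has_power_series g a" by blast
  from has_power_series_cmult[OF a, of "-1"] show ?thesis
    by (simp add: ps_coeff_eq[OF a] ps_coeff_eq)
next
  case False
  then have "\<nexists>a. has_power_series (\<lambda>x. - g x) a"
    using has_power_series_cmult[of "\<lambda>x. - g x" _ "-1"] by auto
  \<comment> \<open>Neither function has an expansion, so both predicates are constantly false and
    their definite descriptions denote the same value.\<close>
  with False have "has_power_series (\<lambda>x. - g x) = has_power_series g" by auto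
  then show ?thesis by (simp add: ps_coeff_def)
qed

lemma Metric_space_fock:
  assumes "0 < \<mu>"
  shows "Metric_space (fock_space \<mu> :: (real ^ 'n::finite \<Rightarrow> real) set) (norm_dist (fock_norm \<mu>))"
proof
  fix g h k :: "real ^ 'n \<Rightarrow> real"
  show "0 \<le> norm_dist (fock_norm \<mu>) g h"
    using assms by (simp add: norm_dist_def fock_norm_nonneg)
  show "norm_dist (fock_norm \<mu>) g h = norm_dist (fock_norm \<mu>) h g"
    using ps_coeff_uminus[of "\<lambda>x. g x - h x"] by (simp add: norm_dist_def fock_norm_def)
  assume g: "g \<in> fock_space \<mu>" and h: "h \<in> fock_space \<mu>"
  show "norm_dist (fock_norm \<mu>) g h = 0 \<longleftrightarrow> g = h"
  proof
    assume "norm_dist (fock_norm \<mu>) g h = 0"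
    then have *: "(\<Sum>\<^sub>\<infinity>\<alpha>. (ps_coeff g \<alpha> - ps_coeff h \<alpha>)\<^sup>2 * mi_weight \<mu> \<alpha>) \<le> 0"
      using fock_norm_sq[OF assms, of "\<lambda>x. g x - h x"] by (simp add: norm_dist_def ps_coeff_diff[OF g h])
    have "(ps_coeff g \<alpha> - ps_coeff h \<alpha>)\<^sup>2 * mi_weight \<mu> \<alpha> = 0" for \<alpha>
      by (rule nonneg_infsum_le_0D[OF *])
         (use fock_space_diff(1)[OF assms g h] assms in
           \<open>auto simp: fock_space_iff ps_coeff_diff[OF g h]\<close>)
    then have "ps_coeff g = ps_coeff h"
      using mi_weight_pos[OF assms] by (auto simp: less_le)
    then show "g = h" using g h has_power_series_unique_fun by (auto simp: fock_space_iff)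
  next
    assume "g = h"
    then show "norm_dist (fock_norm \<mu>) g h = 0"
      by (simp add: norm_dist_def fock_norm_def ps_coeff_eq[of _ "\<lambda>_. 0"] has_power_series_def)
  qed
  assume k: "k \<in> fock_space \<mu>"
  show "norm_dist (fock_norm \<mu>) g k \<le> norm_dist (fock_norm \<mu>) g h + norm_dist (fock_norm \<mu>) h k"
    using fock_space_add(2)[OF assms fock_space_diff(1)[OF assms g h] fock_space_diff(1)[OF assms h k]]
    by (simp add: norm_dist_def)
qed

section \<open>Bounded operators between native spaces\<close>

definition fock_bounded ::
  "real \<Rightarrow> real \<Rightarrow> ((real ^ 'n::finite \<Rightarrow> real) \<Rightarrow> real ^ 'n \<Rightarrow> real) \<Rightarrow> bool" where
  "fock_bounded \<mu> \<nu> T \<longleftrightarrow>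
    (\<exists>C\<ge>0. \<forall>g\<in>fock_space \<mu>. T g \<in> fock_space \<nu> \<and> fock_norm \<nu> (T g) \<le> C * fock_norm \<mu> g)"

lemma fock_boundedI:
  "0 \<le> C \<Longrightarrow> (\<And>g. g \<in> fock_space \<mu> \<Longrightarrow> T g \<in> fock_space \<nu>) \<Longrightarrow>
    (\<And>g. g \<in> fock_space \<mu> \<Longrightarrow> fock_norm \<nu> (T g) \<le> C * fock_norm \<mu> g) \<Longrightarrow> fock_bounded \<mu> \<nu> T"
  unfolding fock_bounded_def by blast

lemma fock_bounded_add:
  assumes "0 < \<nu>" "fock_bounded \<mu> \<nu> S" "fock_bounded \<mu> \<nu> T"
  shows "fock_bounded \<mu> \<nu> (\<lambda>g x. S g x + T g x)"
proof -
  obtain C where C: "0 \<le> C" "\<And>g. g \<in> fock_space \<mu> \<Longrightarrow> S g \<in> fock_space \<nu>"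
    "\<And>g. g \<in> fock_space \<mu> \<Longrightarrow> fock_norm \<nu> (S g) \<le> C * fock_norm \<mu> g"
    using assms(2) unfolding fock_bounded_def by blast
  obtain D where D: "0 \<le> D" "\<And>g. g \<in> fock_space \<mu> \<Longrightarrow> T g \<in> fock_space \<nu>"
    "\<And>g. g \<in> fock_space \<mu> \<Longrightarrow> fock_norm \<nu> (T g) \<le> D * fock_norm \<mu> g"
    using assms(3) unfolding fock_bounded_def by blast
  show ?thesis
  proof (rule fock_boundedI[of "C + D"])
    fix g :: "real ^ 'a \<Rightarrow> real" assume g: "g \<in> fock_space \<mu>"
    show "(\<lambda>x. S g x + T g x) \<in> fock_space \<nu>"
      using fock_space_add(1)[OF assms(1) C(2)[OF g] D(2)[OF g]] .
    show "fock_norm \<nu> (\<lambda>x. S g x + T g x) \<le> (C + D) * fock_norm \<mu> g"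
      using fock_space_add(2)[OF assms(1) C(2)[OF g] D(2)[OF g]] C(3)[OF g] D(3)[OF g]
      by (simp add: distrib_right)
  qed (use C D in simp)
qed

lemma fock_bounded_comp:
  assumes "fock_bounded \<mu> \<nu> S" "fock_bounded \<nu> \<rho> T"
  shows "fock_bounded \<mu> \<rho> (\<lambda>g. T (S g))"
proof -
  obtain C where C: "0 \<le> C" "\<And>g. g \<in> fock_space \<mu> \<Longrightarrow> S g \<in> fock_space \<nu>"
    "\<And>g. g \<in> fock_space \<mu> \<Longrightarrow> fock_norm \<nu> (S g) \<le> C * fock_norm \<mu> g"
    using assms(1) unfolding fock_bounded_def by blast
  obtain D where D: "0 \<le> D" "\<And>g. g \<in> fock_space \<nu> \<Longrightarrow> T g \<in> fock_space \<rho>"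
    "\<And>g. g \<in> fock_space \<nu> \<Longrightarrow> fock_norm \<rho> (T g) \<le> D * fock_norm \<nu> g"
    using assms(2) unfolding fock_bounded_def by blast
  show ?thesis
  proof (rule fock_boundedI[of "D * C"])
    fix g :: "real ^ 'a \<Rightarrow> real" assume g: "g \<in> fock_space \<mu>"
    show "T (S g) \<in> fock_space \<rho>" using C D g by blast
    have "fock_norm \<rho> (T (S g)) \<le> D * fock_norm \<nu> (S g)" using C D g by blast
    also have "\<dots> \<le> D * (C * fock_norm \<mu> g)" using C D g by (intro mult_left_mono) auto
    finally show "fock_norm \<rho> (T (S g)) \<le> D * C * fock_norm \<mu> g" by (simp add: mult.assoc)
  qed (use C D in simp)
qed

lemma fock_bounded_cmult: "0 < \<mu> \<Longrightarrow> fock_bounded \<mu> \<mu> (\<lambda>g x. c * g x)"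
  by (rule fock_boundedI[of "\<bar>c\<bar>"]) (auto intro: fock_space_cmult)

lemma fock_bounded_sum:
  assumes "0 < \<mu>" "0 < \<nu>" "finite I"
    and "\<And>i. i \<in> I \<Longrightarrow> fock_bounded \<mu> \<nu> (T i)"
  shows "fock_bounded \<mu> \<nu> (\<lambda>g x. \<Sum>i\<in>I. T i g x)"
  using assms(3,4)
proof (induction I rule: finite_induct)
  case empty
  have "has_power_series (\<lambda>_. 0) (\<lambda>_. 0)" by (simp add: has_power_series_def)
  from fock_spaceI[OF assms(2) this, of 0] show ?case
    by (intro fock_boundedI[of 0]) auto
next
  case (insert i I)
  have "fock_bounded \<mu> \<nu> (\<lambda>g x. T i g x + (\<Sum>j\<in>I. T j g x))"
    using insert by (intro fock_bounded_add[OF assms(2)]) auto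
  then show ?case using insert by simp
qed

text \<open>Raising the exponent \<open>\<beta> i\<close> multiplies the weight by
  \<open>(\<beta> i + 1) / \<nu>\<close>, a factor linear in the degree that
  \<open>mi_weight_absorb\<close> removes.\<close>

lemma fock_bounded_coord:
  assumes "0 < \<mu>" "\<mu> < \<nu>"
  shows "fock_bounded \<mu> \<nu> (\<lambda>g (x :: real ^ 'n::finite). x $ i * g x)"
proof -
  have \<nu>: "0 < \<nu>" using assms by simp
  obtain C where C: "0 \<le> C"
    "\<And>\<alpha> :: 'n \<Rightarrow> nat. (real (mi_abs \<alpha>) + 1) * mi_weight \<nu> \<alpha> \<le> C * mi_weight \<mu> \<alpha>"
    using mi_weight_absorb[OF assms] by blast
  have le: "mi_weight \<nu> (\<beta>(i := Suc (\<beta> i))) \<le> C / \<nu> * mi_weight \<mu> \<beta>" for \<beta> :: "'n \<Rightarrow> nat"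
  proof -
    have "(real (\<beta> i) + 1) * mi_weight \<nu> \<beta> \<le> (real (mi_abs \<beta>) + 1) * mi_weight \<nu> \<beta>"
      using le_mi_abs[of \<beta> i] mi_weight_pos[OF \<nu>, of \<beta>] by (intro mult_right_mono) auto
    also note C(2)[of \<beta>]
    finally have "(real (\<beta> i) + 1) * mi_weight \<nu> \<beta> / \<nu> \<le> C * mi_weight \<mu> \<beta> / \<nu>"
      using \<nu> by (intro divide_right_mono) auto
    then show ?thesis using \<nu> by (simp add: mi_weight_Suc)
  qed
  let ?\<sigma> = "\<lambda>\<alpha> :: 'n \<Rightarrow> nat. \<alpha>(i := \<alpha> i - 1)"
  have inj: "inj_on ?\<sigma> {\<alpha>. \<alpha> i \<noteq> 0}"
    by (rule inj_on_inverseI[of _ "\<lambda>\<alpha>. \<alpha>(i := Suc (\<alpha> i))"]) auto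
  \<comment> \<open>A square root, since the shift estimate compares squared coefficients.\<close>
  obtain D where D: "0 \<le> D" "D\<^sup>2 = C / \<nu>"
    using C(1) \<nu> by (intro that[of "sqrt (C / \<nu>)"]) auto
  show ?thesis
  proof (rule fock_boundedI[OF D(1)])
    fix g :: "real ^ 'n \<Rightarrow> real" assume g: "g \<in> fock_space \<mu>"
    define b where "b \<alpha> = (if \<alpha> i = 0 then 0 else ps_coeff g (?\<sigma> \<alpha>))" for \<alpha>
    have ps: "has_power_series (\<lambda>x. x $ i * g x) b"
      using g has_power_series_coord[of g "ps_coeff g" i] by (simp add: fock_space_iff b_def[abs_def])
    have b_le: "(b \<alpha>)\<^sup>2 * mi_weight \<nu> \<alpha> \<le> D\<^sup>2 * ((ps_coeff g (?\<sigma> \<alpha>))\<^sup>2 * mi_weight \<mu> (?\<sigma> \<alpha>))"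
      if "\<alpha> \<in> {\<alpha>. \<alpha> i \<noteq> 0}" for \<alpha>
      using mult_left_mono[OF le[of "?\<sigma> \<alpha>"], of "(ps_coeff g (?\<sigma> \<alpha>))\<^sup>2"] that
      by (simp add: mult_ac b_def D(2))
    have b_0: "b \<alpha> = 0" if "\<alpha> \<notin> {\<alpha>. \<alpha> i \<noteq> 0}" for \<alpha> using that by (simp add: b_def)
    note * = fock_space_weighted_shift[OF assms(1) \<nu> g ps D(1) inj b_0 b_le]
    show "(\<lambda>x. x $ i * g x) \<in> fock_space \<nu>" by (rule *(1))
    show "fock_norm \<nu> (\<lambda>x. x $ i * g x) \<le> D * fock_norm \<mu> g" by (rule *(2))
  qed
qed

text \<open>The squared coefficient brings in \<open>(\<alpha> i + 1)\<close> twice. One factor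
  turns the weight at \<open>\<alpha>\<close> into the weight at the raised index, up to
  \<open>\<nu>\<close>; only a linear factor is left to absorb.\<close>

lemma fock_bounded_partial_deriv:
  assumes "0 < \<mu>" "\<mu> < \<nu>"
  shows "fock_bounded \<mu> \<nu> (partial_deriv (i :: 'n::finite))"
proof -
  have \<nu>: "0 < \<nu>" using assms by simp
  obtain C where C: "0 \<le> C"
    "\<And>\<alpha> :: 'n \<Rightarrow> nat. (real (mi_abs \<alpha>) + 1) * mi_weight \<nu> \<alpha> \<le> C * mi_weight \<mu> \<alpha>"
    using mi_weight_absorb[OF assms] by blast
  let ?\<sigma> = "\<lambda>\<alpha> :: 'n \<Rightarrow> nat. \<alpha>(i := Suc (\<alpha> i))"
  have le: "(real (\<alpha> i) + 1)\<^sup>2 * mi_weight \<nu> \<alpha> \<le> \<nu> * C * mi_weight \<mu> (?\<sigma> \<alpha>)" for \<alpha>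
  proof -
    have "(real (\<alpha> i) + 1)\<^sup>2 * mi_weight \<nu> \<alpha> = \<nu> * ((real (\<alpha> i) + 1) * mi_weight \<nu> (?\<sigma> \<alpha>))"
      using \<nu> by (simp add: mi_weight_Suc power2_eq_square)
    also have "\<dots> \<le> \<nu> * ((real (mi_abs (?\<sigma> \<alpha>)) + 1) * mi_weight \<nu> (?\<sigma> \<alpha>))"
      using le_mi_abs[of \<alpha> i] mi_weight_pos[OF \<nu>, of "?\<sigma> \<alpha>"] \<nu>
      by (intro mult_left_mono mult_right_mono) (auto simp: mi_abs_Suc)
    also have "\<dots> \<le> \<nu> * (C * mi_weight \<mu> (?\<sigma> \<alpha>))"
      using C(2)[of "?\<sigma> \<alpha>"] \<nu> by (intro mult_left_mono) auto
    finally show ?thesis by (simp add: mult.assoc)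
  qed
  obtain D where D: "0 \<le> D" "D\<^sup>2 = \<nu> * C"
    using C(1) \<nu> by (intro that[of "sqrt (\<nu> * C)"]) auto
  show ?thesis
  proof (rule fock_boundedI[OF D(1)])
    fix g :: "real ^ 'n \<Rightarrow> real" assume g: "g \<in> fock_space \<mu>"
    define b where "b \<alpha> = (real (\<alpha> i) + 1) * ps_coeff g (?\<sigma> \<alpha>)" for \<alpha>
    have ps: "has_power_series (partial_deriv i g) b"
      using g has_power_series_partial_deriv[of g "ps_coeff g" i]
      by (simp add: fock_space_iff b_def[abs_def])
    have b_le: "(b \<alpha>)\<^sup>2 * mi_weight \<nu> \<alpha> \<le> D\<^sup>2 * ((ps_coeff g (?\<sigma> \<alpha>))\<^sup>2 * mi_weight \<mu> (?\<sigma> \<alpha>))" for \<alpha>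
      using mult_left_mono[OF le[of \<alpha>], of "(ps_coeff g (?\<sigma> \<alpha>))\<^sup>2"]
      by (simp add: mult_ac power_mult_distrib b_def D(2))
    have b_0: "b \<alpha> = 0" if "\<alpha> \<notin> UNIV" for \<alpha> using that by simp
    note * = fock_space_weighted_shift[OF assms(1) \<nu> g ps D(1) inj_Suc_upd b_0 b_le]
    show "partial_deriv i g \<in> fock_space \<nu>" by (rule *(1))
    show "fock_norm \<nu> (partial_deriv i g) \<le> D * fock_norm \<mu> g" by (rule *(2))
  qed
qed

text \<open>The weights decrease as the parameter grows.\<close>

lemma fock_bounded_inclusion:
  assumes "0 < \<mu>" "\<mu> < \<nu>"
  shows "fock_bounded \<mu> \<nu> (\<lambda>g :: real ^ 'n::finite \<Rightarrow> real. g)"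
proof (rule fock_boundedI[of 1])
  have \<nu>: "0 < \<nu>" using assms by simp
  have "mi_weight \<nu> \<alpha> \<le> mi_weight \<mu> \<alpha>" for \<alpha> :: "'n \<Rightarrow> nat"
    using assms mi_fact_pos[of \<alpha>] unfolding mi_weight_def
    by (intro divide_left_mono power_mono) auto
  then have le: "c\<^sup>2 * mi_weight \<nu> \<alpha> \<le> 1\<^sup>2 * (c\<^sup>2 * mi_weight \<mu> \<alpha>)" for c and \<alpha> :: "'n \<Rightarrow> nat"
    by (auto intro: mult_left_mono)
  fix g :: "real ^ 'n \<Rightarrow> real" assume g: "g \<in> fock_space \<mu>"
  then have "has_power_series g (ps_coeff g)" by (simp add: fock_space_iff)
  note * = fock_space_weighted_shift[OF assms(1) \<nu> g this, of 1 "\<lambda>\<alpha>. \<alpha>" UNIV]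
  show "g \<in> fock_space \<nu>" and "fock_norm \<nu> g \<le> 1 * fock_norm \<mu> g"
    by (rule *; use le in simp)+
qed simp

text \<open>Induction on the construction of the polynomial, for all parameter pairs at once because
  a product has to divide the gap between its two factors.\<close>

lemma fock_bounded_mult_polynomial:
  fixes p :: "real ^ 'n::finite \<Rightarrow> real"
  assumes "real_polynomial_function p" "0 < \<mu>" "\<mu> < \<nu>"
  shows "fock_bounded \<mu> \<nu> (\<lambda>g x. p x * g x)"
  using assms
proof (induction arbitrary: \<mu> \<nu> rule: real_polynomial_function.induct)
  case (linear p)
  \<comment> \<open>A linear functional is a combination of coordinates, which reduces this case to
    \<open>fock_bounded_coord\<close>.\<close>
  have p: "p x = (\<Sum>i\<in>UNIV. p (axis i 1) * x $ i)" for x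
  proof -
    interpret p: bounded_linear p by fact
    have "p x = p (\<Sum>i\<in>UNIV. x $ i *\<^sub>R axis i 1)"
      by (simp add: basis_expansion flip: scalar_mult_eq_scaleR)
    then show ?thesis by (simp add: p.sum p.scaleR mult.commute)
  qed
  have "fock_bounded \<mu> \<nu> (\<lambda>g x. \<Sum>i\<in>UNIV. p (axis i 1) * (x $ i * g x))"
    using linear.prems
    by (intro fock_bounded_sum fock_bounded_comp[OF fock_bounded_coord fock_bounded_cmult]) auto
  moreover have "(\<Sum>i\<in>UNIV. p (axis i 1) * (x $ i * g x)) = p x * g x" for g x
    by (subst (2) p) (simp add: sum_distrib_right mult.assoc)
  ultimately show ?case by simp
next
  case (const c)
  then show ?case using fock_bounded_comp[OF fock_bounded_cmult fock_bounded_inclusion] by simp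
next
  case (add p q)
  then have "fock_bounded \<mu> \<nu> (\<lambda>g x. p x * g x + q x * g x)"
    by (intro fock_bounded_add) auto
  then show ?case by (simp add: distrib_right)
next
  case (mult p q)
  \<comment> \<open>Multiplication by \<open>q\<close> leads from \<open>\<mu>\<close> to
    \<open>\<kappa>\<close>, multiplication by \<open>p\<close> from \<open>\<kappa>\<close> to
    \<open>\<nu>\<close>.\<close>
  obtain \<kappa> where \<kappa>: "\<mu> < \<kappa>" "\<kappa> < \<nu>" using mult.prems dense by blast
  have "fock_bounded \<mu> \<nu> (\<lambda>g x. p x * (q x * g x))"
    by (rule fock_bounded_comp[where \<nu> = \<kappa>]) (use mult \<kappa> in auto)
  then show ?case by (simp add: mult.assoc)
qed

lemma fock_bounded_liouville:
  fixes f :: "real ^ 'n::finite \<Rightarrow> real ^ 'n"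
  assumes "0 < \<mu>" "\<mu> < \<nu>" and "\<And>i. real_polynomial_function (\<lambda>x. f x $ i)"
  shows "fock_bounded \<mu> \<nu> (liouville f)"
proof -
  \<comment> \<open>Differentiation uses the gap up to \<open>\<kappa>\<close>, multiplication by
    the component of \<open>f\<close> the rest.\<close>
  obtain \<kappa> where \<kappa>: "\<mu> < \<kappa>" "\<kappa> < \<nu>" using assms dense by blast
  have "fock_bounded \<mu> \<nu> (\<lambda>g x. f x $ i * partial_deriv i g x)" for i
    by (rule fock_bounded_comp[OF fock_bounded_partial_deriv fock_bounded_mult_polynomial[OF assms(3)], of _ \<kappa>])
       (use assms \<kappa> in auto)
  then have "fock_bounded \<mu> \<nu> (\<lambda>g x. \<Sum>i\<in>UNIV. f x $ i * partial_deriv i g x)"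
    using assms by (intro fock_bounded_sum) auto
  then show ?thesis by (simp add: liouville_def[abs_def])
qed

section \<open>Compactness\<close>

text \<open>A finite set of multi-indices lies in a box, over which the sum of products factors into
  a product of one-dimensional partial sums.\<close>

lemma summable_on_prod_multi_index:
  fixes \<phi> :: "'n::finite \<Rightarrow> nat \<Rightarrow> real"
  assumes "\<And>i k. 0 \<le> \<phi> i k" "\<And>i. summable (\<phi> i)"
  shows "(\<lambda>\<alpha>. \<Prod>i\<in>UNIV. \<phi> i (\<alpha> i)) summable_on UNIV"
proof (rule nonneg_bounded_partial_sums_imp_summable_on)
  show "\<forall>\<^sub>F F in finite_subsets_at_top UNIV.
      (\<Sum>\<alpha>\<in>F. \<Prod>i\<in>UNIV. \<phi> i (\<alpha> i)) \<le> (\<Prod>i\<in>UNIV. suminf (\<phi> i))"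
  proof (rule eventually_finite_subsets_at_top_weakI)
    fix F :: "('n \<Rightarrow> nat) set"
    assume F: "finite F"
    define N where "N = Max (insert 0 (mi_abs ` F))"
    have "mi_abs \<alpha> \<le> N" if "\<alpha> \<in> F" for \<alpha> unfolding N_def using that F by (intro Max_ge) auto
    then have "\<alpha> i \<le> N" if "\<alpha> \<in> F" for \<alpha> i using that le_mi_abs order_trans by blast
    then have "F \<subseteq> PiE UNIV (\<lambda>_. {..N})" by auto
    then have "(\<Sum>\<alpha>\<in>F. \<Prod>i\<in>UNIV. \<phi> i (\<alpha> i)) \<le> (\<Sum>\<alpha>\<in>PiE UNIV (\<lambda>_. {..N}). \<Prod>i\<in>UNIV. \<phi> i (\<alpha> i))"
      using assms(1) by (intro sum_mono2 finite_PiE prod_nonneg) auto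
    also have "\<dots> = (\<Prod>i\<in>UNIV. \<Sum>k\<le>N. \<phi> i k)" by (simp add: prod_sum_PiE)
    also have "\<dots> \<le> (\<Prod>i\<in>UNIV. suminf (\<phi> i))"
      using assms by (intro prod_mono) (auto intro!: sum_nonneg sum_le_suminf)
    finally show "(\<Sum>\<alpha>\<in>F. \<Prod>i\<in>UNIV. \<phi> i (\<alpha> i)) \<le> (\<Prod>i\<in>UNIV. suminf (\<phi> i))" .
  qed
qed (use assms(1) in \<open>auto intro: prod_nonneg\<close>)

text \<open>This is the expansion of \<open>exp (\<mu> * (x \<bullet> x))\<close>, the kernel on the
  diagonal, as a product of one-dimensional exponential series.\<close>

lemma summable_on_mi_exp:
  fixes x :: "real ^ 'n::finite"
  assumes "0 < \<mu>"
  shows "(\<lambda>\<alpha>. (mi_power x \<alpha>)\<^sup>2 / mi_weight \<mu> \<alpha>) summable_on UNIV"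
proof -
  have "(\<lambda>\<alpha>. \<Prod>i\<in>UNIV. inverse (fact (\<alpha> i)) * (\<mu> * (x $ i)\<^sup>2) ^ \<alpha> i) summable_on UNIV"
    using assms by (intro summable_on_prod_multi_index summable_exp) auto
  moreover have "(\<Prod>i\<in>UNIV. inverse (fact (\<alpha> i)) * (\<mu> * (x $ i)\<^sup>2) ^ \<alpha> i)
      = (mi_power x \<alpha>)\<^sup>2 / mi_weight \<mu> \<alpha>" for \<alpha>
  proof -
    have "(\<Prod>i\<in>UNIV. inverse (fact (\<alpha> i) :: real)) = inverse (mi_fact \<alpha>)"
      by (simp add: mi_fact_def prod_inversef[unfolded o_def])
    moreover have "(\<Prod>i\<in>UNIV. \<mu> ^ \<alpha> i) = \<mu> ^ mi_abs \<alpha>"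
      by (simp add: mi_abs_def power_sum)
    moreover have "(\<Prod>i\<in>UNIV. ((x $ i)\<^sup>2) ^ \<alpha> i) = (mi_power x \<alpha>)\<^sup>2"
      by (simp add: mi_power_def prod_power_distrib power_mult[symmetric] mult.commute)
    ultimately show ?thesis
      by (simp add: prod.distrib power_mult_distrib mi_weight_def divide_inverse)
  qed
  ultimately show ?thesis by simp
qed

text \<open>By the inequality of arithmetic and geometric means, a weighted square summable family of
  coefficients is dominated by the series of the kernel on the diagonal.\<close>

lemma ex_has_power_series:
  fixes a :: "('n::finite \<Rightarrow> nat) \<Rightarrow> real"
  assumes "0 < \<mu>" "(\<lambda>\<alpha>. (a \<alpha>)\<^sup>2 * mi_weight \<mu> \<alpha>) summable_on UNIV"
  obtains g :: "real ^ 'n \<Rightarrow> real" where "has_power_series g a"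
proof
  show "has_power_series (\<lambda>x. \<Sum>\<^sub>\<infinity>\<alpha>. a \<alpha> * mi_power x \<alpha>) a"
    unfolding has_power_series_def
  proof
    fix x :: "real ^ 'n"
    have "(\<lambda>\<alpha>. (a \<alpha>)\<^sup>2 * mi_weight \<mu> \<alpha> + (mi_power x \<alpha>)\<^sup>2 / mi_weight \<mu> \<alpha>) summable_on UNIV"
      using assms summable_on_mi_exp by (intro summable_on_add) auto
    then have "(\<lambda>\<alpha>. norm (a \<alpha> * mi_power x \<alpha>)) summable_on UNIV"
    proof (rule summable_on_comparison_test, goal_cases)
      case (1 \<alpha>)
      define w where "w = mi_weight \<mu> \<alpha>"
      have w: "0 < w" unfolding w_def using assms(1) by (rule mi_weight_pos)
      \<comment> \<open>Distributing \<open>sqrt w\<close> in this way makes the weights cancel in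
        the product while each square acquires the weight of its own series.\<close>
      have "2 * ((\<bar>a \<alpha>\<bar> * sqrt w) * (\<bar>mi_power x \<alpha>\<bar> / sqrt w))
          \<le> (\<bar>a \<alpha>\<bar> * sqrt w)\<^sup>2 + (\<bar>mi_power x \<alpha>\<bar> / sqrt w)\<^sup>2"
        using sum_squares_bound[of "\<bar>a \<alpha>\<bar> * sqrt w" "\<bar>mi_power x \<alpha>\<bar> / sqrt w"]
        by (simp only: mult.assoc)
      then have "2 * (\<bar>a \<alpha>\<bar> * \<bar>mi_power x \<alpha>\<bar>) \<le> (a \<alpha>)\<^sup>2 * w + (mi_power x \<alpha>)\<^sup>2 / w"
        using w by (simp add: power_mult_distrib power_divide)
      moreover have "0 \<le> \<bar>a \<alpha>\<bar> * \<bar>mi_power x \<alpha>\<bar>" by simp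
      ultimately show ?case unfolding real_norm_def abs_mult w_def[symmetric] by linarith
    qed auto
    then show "((\<lambda>\<alpha>. a \<alpha> * mi_power x \<alpha>) has_sum (\<Sum>\<^sub>\<infinity>\<alpha>. a \<alpha> * mi_power x \<alpha>)) UNIV"
      by (rule has_sum_infsum[OF abs_summable_summable])
  qed
qed

text \<open>Passing from \<open>\<mu>\<close> to \<open>\<nu>\<close>, the weights of degree above \<open>N\<close> gain the factor \<open>(\<mu> / \<nu>) ^ N\<close>,
  so the tails are uniformly small and coefficientwise convergence suffices.\<close>

lemma fock_norm_tendsto_0:
  fixes d :: "nat \<Rightarrow> real ^ 'n::finite \<Rightarrow> real"
  assumes "0 < \<mu>" "\<mu> < \<nu>"
    and d: "\<And>m. d m \<in> fock_space \<mu>" "\<And>m. fock_norm \<mu> (d m) \<le> c"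
    and lim: "\<And>\<alpha>. (\<lambda>m. ps_coeff (d m) \<alpha>) \<longlonglongrightarrow> 0"
  shows "(\<lambda>m. fock_norm \<nu> (d m)) \<longlonglongrightarrow> 0"
proof (rule LIMSEQ_I)
  fix e :: real assume e: "0 < e"
  define r where "r = \<mu> / \<nu>"
  have r: "0 < r" "r < 1" and \<nu>: "0 < \<nu>" using assms by (auto simp: r_def)
  have "(\<lambda>N. r ^ N * c\<^sup>2) \<longlonglongrightarrow> 0 * c\<^sup>2"
    using r by (intro tendsto_mult LIMSEQ_realpow_zero) auto
  \<comment> \<open>The squared norm is to be at most \<open>(e / 2)\<^sup>2\<close>: half of it is
    allotted to degrees above \<open>N\<close>, half to the finitely many indices of degree at most
    \<open>N\<close>. Aiming at \<open>e / 2\<close> yields the strict bound by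
    \<open>e\<close>.\<close>
  then have "\<forall>\<^sub>F N in sequentially. r ^ N * c\<^sup>2 < (e / 2)\<^sup>2 / 2"
    using e by (intro order_tendstoD(2)) auto
  then obtain N where N: "r ^ N * c\<^sup>2 < (e / 2)\<^sup>2 / 2" by (auto simp: eventually_sequentially)
  define G where "G = {\<alpha> :: 'n \<Rightarrow> nat. mi_abs \<alpha> \<le> N}"
  have G: "finite G" unfolding G_def by (rule finite_mi_abs_le)
  have "(\<lambda>m. \<Sum>\<alpha>\<in>G. (ps_coeff (d m) \<alpha>)\<^sup>2 * mi_weight \<nu> \<alpha>) \<longlonglongrightarrow> (\<Sum>\<alpha>\<in>G. 0\<^sup>2 * mi_weight \<nu> \<alpha>)"
    using lim by (intro tendsto_intros)
  then have "\<forall>\<^sub>F m in sequentially. (\<Sum>\<alpha>\<in>G. (ps_coeff (d m) \<alpha>)\<^sup>2 * mi_weight \<nu> \<alpha>) < (e / 2)\<^sup>2 / 2"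
    using e by (intro order_tendstoD(2)) auto
  then obtain M where M: "\<And>m. M \<le> m \<Longrightarrow> (\<Sum>\<alpha>\<in>G. (ps_coeff (d m) \<alpha>)\<^sup>2 * mi_weight \<nu> \<alpha>) < (e / 2)\<^sup>2 / 2"
    by (auto simp: eventually_sequentially)
  have "norm (fock_norm \<nu> (d m) - 0) < e" if m: "M \<le> m" for m
  proof -
    let ?a = "ps_coeff (d m)"
    have "(\<Sum>\<alpha>\<in>F. (?a \<alpha>)\<^sup>2 * mi_weight \<nu> \<alpha>) \<le> (e / 2)\<^sup>2" if F: "finite F" for F
    proof -
      have "(\<Sum>\<alpha>\<in>F \<inter> G. (?a \<alpha>)\<^sup>2 * mi_weight \<nu> \<alpha>) \<le> (\<Sum>\<alpha>\<in>G. (?a \<alpha>)\<^sup>2 * mi_weight \<nu> \<alpha>)"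
        using G \<nu> by (intro sum_mono2) auto
      moreover have "(\<Sum>\<alpha>\<in>F - G. (?a \<alpha>)\<^sup>2 * mi_weight \<nu> \<alpha>) \<le> r ^ N * c\<^sup>2"
      proof -
        have "(?a \<alpha>)\<^sup>2 * mi_weight \<nu> \<alpha> \<le> r ^ N * ((?a \<alpha>)\<^sup>2 * mi_weight \<mu> \<alpha>)" if "\<alpha> \<in> F - G" for \<alpha>
        proof -
          have "r ^ mi_abs \<alpha> \<le> r ^ N" using that r by (intro power_decreasing) (auto simp: G_def)
          then have "r ^ mi_abs \<alpha> * ((?a \<alpha>)\<^sup>2 * mi_weight \<mu> \<alpha>) \<le> r ^ N * ((?a \<alpha>)\<^sup>2 * mi_weight \<mu> \<alpha>)"
            using assms(1) by (intro mult_right_mono) auto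
          then show ?thesis using mi_weight_change[OF assms(1) \<nu>, of \<alpha>] by (simp add: r_def mult_ac)
        qed
        then have "(\<Sum>\<alpha>\<in>F - G. (?a \<alpha>)\<^sup>2 * mi_weight \<nu> \<alpha>) \<le> r ^ N * (\<Sum>\<alpha>\<in>F - G. (?a \<alpha>)\<^sup>2 * mi_weight \<mu> \<alpha>)"
          unfolding sum_distrib_left by (intro sum_mono) auto
        also have "\<dots> \<le> r ^ N * (fock_norm \<mu> (d m))\<^sup>2"
          using finite_sum_le_fock_norm[OF assms(1) d(1)] F r by (intro mult_left_mono) auto
        also have "\<dots> \<le> r ^ N * c\<^sup>2"
          using d(2) fock_norm_nonneg[OF assms(1)] r by (intro mult_left_mono power_mono) auto
        finally show ?thesis .
      qed
      ultimately show ?thesis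
        using M[OF m] N sum.Int_Diff[OF F, of "\<lambda>\<alpha>. (?a \<alpha>)\<^sup>2 * mi_weight \<nu> \<alpha>" G] by linarith
    qed
    then have "fock_norm \<nu> (d m) \<le> e / 2"
      using d(1) e by (intro fock_spaceI(2)[OF \<nu>, of _ ?a]) (auto simp: fock_space_iff)
    then show ?thesis using e fock_norm_nonneg[OF \<nu>, of "d m"] by simp
  qed
  then show "\<exists>M. \<forall>m\<ge>M. norm (fock_norm \<nu> (d m) - 0) < e" by blast
qed

text \<open>Sequential compactness suffices in a metric space. The limit of the coefficients obeys
  the same bound on finite sums, so it defines a function in the same ball, and the ball itself is
  compact.\<close>

lemma compactin_fock_ball:
  assumes "0 < \<mu>" "\<mu> < \<nu>"
  shows "compactin (norm_topology (fock_space \<nu>) (fock_norm \<nu>))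
    {g :: real ^ 'n::finite \<Rightarrow> real. g \<in> fock_space \<mu> \<and> fock_norm \<mu> g \<le> c}"
    (is "compactin _ ?K")
proof -
  have \<nu>: "0 < \<nu>" using assms by simp
  interpret Metric_space "fock_space \<nu> :: (real ^ 'n \<Rightarrow> real) set" "norm_dist (fock_norm \<nu>)"
    by (rule Metric_space_fock[OF \<nu>])
  have incl: "g \<in> fock_space \<nu>" if "g \<in> fock_space \<mu>" for g :: "real ^ 'n \<Rightarrow> real"
    using fock_bounded_inclusion[OF assms] that by (auto simp: fock_bounded_def)
  have "\<exists>l\<in>?K. \<exists>r. strict_mono r \<and> limitin mtopology (\<sigma> \<circ> r) l sequentially"
    if \<sigma>: "range \<sigma> \<subseteq> ?K" for \<sigma> :: "nat \<Rightarrow> real ^ 'n \<Rightarrow> real"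
  proof -
    have \<sigma>: "\<sigma> m \<in> fock_space \<mu>" "fock_norm \<mu> (\<sigma> m) \<le> c" for m using \<sigma> by auto
    have c: "0 \<le> c" using \<sigma>(2)[of 0] fock_norm_nonneg[OF assms(1), of "\<sigma> 0"] by linarith
    \<comment> \<open>Scaling by the square root of the weight gives one bound for all indices, the
      form that the diagonal extraction takes.\<close>
    have "norm (ps_coeff (\<sigma> m) \<alpha> * sqrt (mi_weight \<mu> \<alpha>)) \<le> c" for m \<alpha>
    proof (rule power2_le_imp_le)
      have "(ps_coeff (\<sigma> m) \<alpha>)\<^sup>2 * mi_weight \<mu> \<alpha> \<le> (fock_norm \<mu> (\<sigma> m))\<^sup>2"
        using finite_sum_le_fock_norm[OF assms(1) \<sigma>(1), of "{\<alpha>}"] by simp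
      also have "\<dots> \<le> c\<^sup>2" using \<sigma>(2) fock_norm_nonneg[OF assms(1)] by (intro power_mono) auto
      finally show "(norm (ps_coeff (\<sigma> m) \<alpha> * sqrt (mi_weight \<mu> \<alpha>)))\<^sup>2 \<le> c\<^sup>2"
        using assms(1) by (simp add: power_mult_distrib)
    qed (rule c)
    then obtain r where r: "strict_mono r"
      and "\<And>\<alpha>. \<exists>l. (\<lambda>m. ps_coeff (\<sigma> (r m)) \<alpha> * sqrt (mi_weight \<mu> \<alpha>)) \<longlonglongrightarrow> l"
      using function_convergent_subsequence[OF countable_multi_indices,
          of "\<lambda>m \<alpha>. ps_coeff (\<sigma> m) \<alpha> * sqrt (mi_weight \<mu> \<alpha>)" c] by (metis UNIV_I)
    then obtain l where l: "\<And>\<alpha>. (\<lambda>m. ps_coeff (\<sigma> (r m)) \<alpha> * sqrt (mi_weight \<mu> \<alpha>)) \<longlonglongrightarrow> l \<alpha>"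
      by metis
    define a where "a \<alpha> = l \<alpha> / sqrt (mi_weight \<mu> \<alpha>)" for \<alpha>
    have a: "(\<lambda>m. ps_coeff (\<sigma> (r m)) \<alpha>) \<longlonglongrightarrow> a \<alpha>" for \<alpha>
    proof -
      have "mi_weight \<mu> \<alpha> \<noteq> 0" using mi_weight_pos[OF assms(1), of \<alpha>] by simp
      then show ?thesis
        using tendsto_divide[OF l[of \<alpha>] tendsto_const[of "sqrt (mi_weight \<mu> \<alpha>)"]] by (simp add: a_def)
    qed
    \<comment> \<open>Finite sums pass to the limit termwise, which keeps the bound
      \<open>c\<^sup>2\<close>.\<close>
    have bound: "(\<Sum>\<alpha>\<in>F. (a \<alpha>)\<^sup>2 * mi_weight \<mu> \<alpha>) \<le> c\<^sup>2" if "finite F" for F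
    proof (rule LIMSEQ_le_const2)
      show "(\<lambda>m. \<Sum>\<alpha>\<in>F. (ps_coeff (\<sigma> (r m)) \<alpha>)\<^sup>2 * mi_weight \<mu> \<alpha>) \<longlonglongrightarrow> (\<Sum>\<alpha>\<in>F. (a \<alpha>)\<^sup>2 * mi_weight \<mu> \<alpha>)"
        using a by (intro tendsto_intros)
      have "(\<Sum>\<alpha>\<in>F. (ps_coeff (\<sigma> (r m)) \<alpha>)\<^sup>2 * mi_weight \<mu> \<alpha>) \<le> c\<^sup>2" for m
        using finite_sum_le_fock_norm[OF assms(1) \<sigma>(1)[of "r m"] that]
          power_mono[OF \<sigma>(2)[of "r m"] fock_norm_nonneg[OF assms(1)], of 2] by linarith
      then show "\<exists>M. \<forall>m\<ge>M. (\<Sum>\<alpha>\<in>F. (ps_coeff (\<sigma> (r m)) \<alpha>)\<^sup>2 * mi_weight \<mu> \<alpha>) \<le> c\<^sup>2" by blast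
    qed
    have "(\<lambda>\<alpha>. (a \<alpha>)\<^sup>2 * mi_weight \<mu> \<alpha>) summable_on UNIV"
      by (rule nonneg_bounded_partial_sums_imp_summable_on[where C = "c\<^sup>2"])
         (use bound assms(1) in \<open>auto intro!: eventually_finite_subsets_at_top_weakI\<close>)
    then obtain h :: "real ^ 'n \<Rightarrow> real" where h: "has_power_series h a"
      using ex_has_power_series[OF assms(1)] by blast
    note hK = fock_spaceI[OF assms(1) h c bound]
    have "(\<lambda>m. fock_norm \<nu> (\<lambda>x. \<sigma> (r m) x - h x)) \<longlonglongrightarrow> 0"
    proof (rule fock_norm_tendsto_0[OF assms])
      show "(\<lambda>x. \<sigma> (r m) x - h x) \<in> fock_space \<mu>" for m
        using fock_space_diff(1)[OF assms(1) \<sigma>(1) hK(1)] .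
      show "fock_norm \<mu> (\<lambda>x. \<sigma> (r m) x - h x) \<le> 2 * c" for m
        using fock_space_diff(2)[OF assms(1) \<sigma>(1)[of "r m"] hK(1)] \<sigma>(2)[of "r m"] hK(2) by linarith
      show "(\<lambda>m. ps_coeff (\<lambda>x. \<sigma> (r m) x - h x) \<alpha>) \<longlonglongrightarrow> 0" for \<alpha>
        using a[of \<alpha>] by (simp add: ps_coeff_diff[OF \<sigma>(1) hK(1)] ps_coeff_eq[OF h] LIM_zero)
    qed
    then have "limitin mtopology (\<sigma> \<circ> r) h sequentially"
      using incl[OF \<sigma>(1)] incl[OF hK(1)]
      by (simp add: limitin_metric_dist_null norm_dist_def o_def)
    then show ?thesis using r hK by blast
  qed
  then show ?thesis
    unfolding norm_topology_def compactin_sequentially using incl by blast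
qed

text \<open>Both sides of each identity for \<open>partial_deriv\<close> have the same power series,
  hence agree as functions.\<close>

lemma linear_between_liouville:
  fixes f :: "real ^ 'n::finite \<Rightarrow> real ^ 'n"
  assumes "\<And>g. g \<in> fock_space \<mu> \<Longrightarrow> liouville f g \<in> W"
  shows "linear_between (fock_space \<mu>) W (liouville f)"
proof -
  have add: "partial_deriv i (\<lambda>x. g x + h x) = (\<lambda>x. partial_deriv i g x + partial_deriv i h x)"
    if "g \<in> fock_space \<mu>" "h \<in> fock_space \<mu>" for i and g h :: "real ^ 'n \<Rightarrow> real"
  proof -
    have g: "has_power_series g (ps_coeff g)" and h: "has_power_series h (ps_coeff h)"
      using that by (simp_all add: fock_space_iff)
    show ?thesis
      by (rule has_power_series_unique_fun[OF
            has_power_series_partial_deriv[OF has_power_series_add[OF g h]]])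
         (use has_power_series_add[OF has_power_series_partial_deriv[OF g, of i]
            has_power_series_partial_deriv[OF h, of i]] in \<open>simp add: distrib_left\<close>)
  qed
  have cmult: "partial_deriv i (\<lambda>x. c * g x) = (\<lambda>x. c * partial_deriv i g x)"
    if "g \<in> fock_space \<mu>" for i c and g :: "real ^ 'n \<Rightarrow> real"
  proof -
    have g: "has_power_series g (ps_coeff g)" using that by (simp add: fock_space_iff)
    show ?thesis
      by (rule has_power_series_unique_fun[OF
            has_power_series_partial_deriv[OF has_power_series_cmult[OF g]]])
         (use has_power_series_cmult[OF has_power_series_partial_deriv[OF g, of i], of c]
          in \<open>simp add: mult.left_commute\<close>)
  qed
  show ?thesis
    unfolding linear_between_def
  proof (intro conjI ballI allI)
    fix g h :: "real ^ 'n \<Rightarrow> real" and c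
    assume g: "g \<in> fock_space \<mu>"
    show "liouville f g \<in> W" using assms g .
    show "liouville f (\<lambda>x. c * g x) = (\<lambda>x. c * liouville f g x)"
      by (simp add: fun_eq_iff liouville_def cmult[OF g] sum_distrib_left mult.left_commute)
    assume h: "h \<in> fock_space \<mu>"
    show "liouville f (\<lambda>x. g x + h x) = (\<lambda>x. liouville f g x + liouville f h x)"
      by (simp add: fun_eq_iff liouville_def add[OF g h] distrib_left sum.distrib)
  qed
qed

theorem theorem3p4:
  fixes f :: "real ^ 'n::finite \<Rightarrow> real ^ 'n" and \<mu>\<^sub>1 \<mu>\<^sub>3 :: real
  assumes "0 < \<mu>\<^sub>1" and "\<mu>\<^sub>1 < \<mu>\<^sub>3"
    and "\<And>i. real_polynomial_function (\<lambda>x. f x $ i)"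
  shows "compact_operator (fock_space \<mu>\<^sub>1) (fock_norm \<mu>\<^sub>1) (fock_space \<mu>\<^sub>3) (fock_norm \<mu>\<^sub>3) (liouville f)"
  unfolding compact_operator_def
proof (intro conjI allI impI)
  obtain \<mu>\<^sub>2 where \<mu>\<^sub>2: "\<mu>\<^sub>1 < \<mu>\<^sub>2" "\<mu>\<^sub>2 < \<mu>\<^sub>3" using assms(2) dense by blast
  have pos: "0 < \<mu>\<^sub>2" "0 < \<mu>\<^sub>3" using assms(1) \<mu>\<^sub>2 by auto
  show "linear_between (fock_space \<mu>\<^sub>1) (fock_space \<mu>\<^sub>3) (liouville f)"
    using fock_bounded_liouville[OF assms]
    by (intro linear_between_liouville) (auto simp: fock_bounded_def)
  fix B :: "(real ^ 'n \<Rightarrow> real) set"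
  assume B: "B \<subseteq> fock_space \<mu>\<^sub>1" and "\<exists>c. \<forall>g\<in>B. fock_norm \<mu>\<^sub>1 g \<le> c"
  then obtain c where c: "\<And>g. g \<in> B \<Longrightarrow> fock_norm \<mu>\<^sub>1 g \<le> c" by blast
  obtain C where C: "0 \<le> C" "\<And>g. g \<in> fock_space \<mu>\<^sub>1 \<Longrightarrow> liouville f g \<in> fock_space \<mu>\<^sub>2"
    "\<And>g. g \<in> fock_space \<mu>\<^sub>1 \<Longrightarrow> fock_norm \<mu>\<^sub>2 (liouville f g) \<le> C * fock_norm \<mu>\<^sub>1 g"
    using fock_bounded_liouville[OF assms(1) \<mu>\<^sub>2(1) assms(3)] unfolding fock_bounded_def by blast
  \<comment> \<open>Boundedness of the operator from \<open>\<mu>\<^sub>1\<close> to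
    \<open>\<mu>\<^sub>2\<close> puts the image of \<open>B\<close> into this ball, which is compact
    for the larger parameter \<open>\<mu>\<^sub>3\<close>.\<close>
  define K where "K = {g :: real ^ 'n \<Rightarrow> real. g \<in> fock_space \<mu>\<^sub>2 \<and> fock_norm \<mu>\<^sub>2 g \<le> C * c}"
  let ?X = "norm_topology (fock_space \<mu>\<^sub>3) (fock_norm \<mu>\<^sub>3) :: (real ^ 'n \<Rightarrow> real) topology"
  have "fock_norm \<mu>\<^sub>2 (liouville f g) \<le> C * c" if "g \<in> B" for g
    using C(3)[of g] B that mult_left_mono[OF c[OF that] C(1)] by fastforce
  then have sub: "liouville f ` B \<subseteq> K" using B C(2) by (auto simp: K_def)
  have K: "compactin ?X K" unfolding K_def by (rule compactin_fock_ball[OF pos(1) \<mu>\<^sub>2(2)])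
  \<comment> \<open>In a Hausdorff space the compact set \<open>K\<close> is closed, so it contains
    the closure of the image, which is then a closed subset of a compact set.\<close>
  have "Hausdorff_space ?X"
    unfolding norm_topology_def
    by (rule Metric_space.Hausdorff_space_mtopology[OF Metric_space_fock[OF pos(2)]])
  then have "?X closure_of (liouville f ` B) \<subseteq> K"
    using K sub by (intro closure_of_minimal compactin_imp_closedin)
  then show "compactin ?X (?X closure_of (liouville f ` B))"
    using K by (rule_tac closed_compactin) auto
qed

end
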